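(* Whenever all the series concerned are either convergent or terminating, $$\sum_{m,n=0}^\infty\frac{(p,m+n)(-1)^n x^{m+n}}{(p,m)(p,n)}L_m^{(p-1)}(y)\,L_n^{(p-1)}(y)={}_0F_1(-;p;-x^2y^2)=\Gamma(p)\,(xy)^{1-p}J_{p-1}(2xy).$$
   Context: Here $p$ is a complex parameter and $x,y$ are complex variables. $(\alpha,n)=\alpha(\alpha+1)\cdots(\alpha+n-1)$ for $n\ge1$ and $(\alpha,0)=1$ (Pochhammer symbol). $\Gamma$ is the Gamma function. ${}_0F_1(-;p;z)=\sum_{n\ge0}\frac{z^n}{(p,n)\,n!}$. The Laguerre polynomial is $L_n^{(a)}(x)=\frac{(a+1,n)}{n!}\,{}_1F_1[-n;a+1;x]$, where ${}_1F_1[\alpha;\beta;z]=\sum_{k\ge0}\frac{(\alpha,k)}{(\beta,k)}\frac{z^k}{k!}$. $J_\nu(z)=\sum_{k\ge0}\frac{(-1)^k(z/2)^{2k+\nu}}{k!\,\Gamma(\nu+k+1)}$ is the Bessel function of the first kind. *)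

theory Defs
  imports "HOL-Analysis.Analysis"
begin

text \<open>
  Convergence of a double series is convergence of its rectangular partial sums as both
  bounds tend to infinity independently (Pringsheim). This is weaker than
  unconditional summability over all pairs of indices, and has the same value when the
  latter holds.
\<close>

definition double_sums :: "(nat \<Rightarrow> nat \<Rightarrow> complex) \<Rightarrow> complex \<Rightarrow> bool" where
  "double_sums a s \<longleftrightarrow>
     ((\<lambda>(M, N). \<Sum>m<M. \<Sum>n<N. a m n) \<longlongrightarrow> s) (sequentially \<times>\<^sub>F sequentially)"

definition double_summable :: "(nat \<Rightarrow> nat \<Rightarrow> complex) \<Rightarrow> bool" where
  "double_summable a \<longleftrightarrow> (\<exists>s. double_sums a s)"

definition double_suminf :: "(nat \<Rightarrow> nat \<Rightarrow> complex) \<Rightarrow> complex" where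
  "double_suminf a = (THE s. double_sums a s)"

definition hyp_0F1 :: "complex \<Rightarrow> complex \<Rightarrow> complex" where
  "hyp_0F1 p z = (\<Sum>n. z ^ n / (pochhammer p n * fact n))"

definition hyp_1F1 :: "complex \<Rightarrow> complex \<Rightarrow> complex \<Rightarrow> complex" where
  "hyp_1F1 \<alpha> \<beta> z = (\<Sum>k. pochhammer \<alpha> k / pochhammer \<beta> k * (z ^ k / fact k))"

definition laguerre :: "nat \<Rightarrow> complex \<Rightarrow> complex \<Rightarrow> complex" where
  "laguerre n a x = pochhammer (a + 1) n / fact n * hyp_1F1 (- of_nat n) (a + 1) x"

text \<open>
  Principal branch of the complex power, with \<open>0\<^sup>0 = 1\<close>; the library
  has \<open>0 powr 0 = 0\<close>, which would give the wrong value of the Bessel function of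
  order 0 at the origin.
\<close>

definition cpow :: "complex \<Rightarrow> complex \<Rightarrow> complex" where
  "cpow z a = (if z = 0 \<and> a = 0 then 1 else z powr a)"

text \<open>
  If \<open>\<nu> + k + 1\<close> is a pole of the Gamma function, then \<open>Gamma (\<nu> + k + 1) = 0\<close>
  and the term vanishes by division by zero, which is the usual
  convention \<open>1 / \<Gamma> = 0\<close> at the poles.
\<close>

definition bessel_J :: "complex \<Rightarrow> complex \<Rightarrow> complex" where
  "bessel_J \<nu> z =
     (\<Sum>k. (-1) ^ k * cpow (z / 2) (2 * of_nat k + \<nu>) / (fact k * Gamma (\<nu> + of_nat k + 1)))"

end

(* Multiplying the generating function e^z 0F1(-; p; -y z) of L_n^{(p-1)}(y) / (p,n) by its value
   at -z cancels the exponentials, and 0F1(-; p; -y z) 0F1(-; p; y z) is evaluated by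
   (1+z)^a (1-z)^a = (1-z^2)^a. Hence the antidiagonals m + n = N of the double series are the terms
   of 0F1(-; p; -x^2 y^2).

   Pringsheim convergence alone does not allow summation along antidiagonals. Here, however, it makes
   the terms bounded for m, n >= K; choosing k > max(m, K) with L_k(y) nonzero, the m-th row is the
   k-th row times a factor of order n^(m-k), so every row and every column tends to 0.
   Then the (C,1) means of the antidiagonal partial sums, being the means of the rectangular partial
   sums over rectangles with M + N fixed, converge to both sums. *)

theory Submission
  imports Defs
begin

unbundle no vec_syntax
unbundle fps_syntax

section \<open>Cesaro means and Pringsheim convergence of double series\<close>

text \<open>On the antidiagonal of index \<open>N\<close> all but \<open>2 * K\<close> points have
  both coordinates at least \<open>K\<close>, where \<open>R\<close> is close to \<open>s\<close>.
  The others lie in finitely many fixed rows and columns, whose entries grow slower than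
  \<open>N\<close> and disappear in the mean.\<close>

lemma tendsto_antidiagonal_mean:
  fixes R :: "nat \<Rightarrow> nat \<Rightarrow> complex"
  assumes lim: "((\<lambda>(M, N). R M N) \<longlongrightarrow> s) (sequentially \<times>\<^sub>F sequentially)"
    and row: "\<And>M. (\<lambda>N. R M N / of_nat (Suc N)) \<longlonglongrightarrow> 0"
    and col: "\<And>N. (\<lambda>M. R M N / of_nat (Suc M)) \<longlonglongrightarrow> 0"
  shows "(\<lambda>N. (\<Sum>M\<le>N. R M (N - M)) / of_nat (Suc N)) \<longlonglongrightarrow> s"
proof -
  \<comment> \<open>For fixed \<open>M\<close>, the entry of row (or column) \<open>M\<close> on
    antidiagonal \<open>N\<close> has its other index equal to \<open>N - M\<close>; this shift is
    harmless because \<open>Suc (N - M)\<close> is at most \<open>Suc N\<close>.\<close>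
  have edge: "(\<lambda>N. norm (Q (N - M) - s) / real (Suc N)) \<longlonglongrightarrow> 0"
    if "(\<lambda>N. Q N / of_nat (Suc N)) \<longlonglongrightarrow> 0" for Q :: "nat \<Rightarrow> complex" and M
  proof -
    have inv: "(\<lambda>N. s / of_nat (Suc N)) \<longlonglongrightarrow> 0"
      using tendsto_mult_right_zero[OF LIMSEQ_Suc[OF lim_inverse_n], of s]
      by (simp add: divide_inverse)
    have "(\<lambda>N. norm (Q N / of_nat (Suc N) - s / of_nat (Suc N))) \<longlonglongrightarrow> 0"
      using tendsto_norm[OF tendsto_diff[OF that inv]] by simp
    then have "(\<lambda>N. norm (Q N - s) / real (Suc N)) \<longlonglongrightarrow> 0"
      by (simp add: norm_divide flip: diff_divide_distrib del: of_nat_Suc)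
    then have sh: "(\<lambda>N. norm (Q (N - M) - s) / real (Suc (N - M))) \<longlonglongrightarrow> 0"
      by (rule filterlim_compose) (rule filterlim_minus_const_nat_at_top)
    show ?thesis
      by (rule Lim_null_comparison[OF _ sh]) (auto intro!: always_eventually divide_left_mono)
  qed
  have "(\<lambda>N. (\<Sum>M\<le>N. R M (N - M) - s) / of_nat (Suc N)) \<longlonglongrightarrow> 0"
  proof (rule LIMSEQ_I)
    fix e :: real assume e: "e > 0"
    have "\<forall>\<^sub>F (M, N) in sequentially \<times>\<^sub>F sequentially. dist (R M N) s < e / 2"
      using tendstoD[OF lim, of "e/2"] e by (simp add: case_prod_unfold)
    then obtain K where K: "\<And>M N. M \<ge> K \<Longrightarrow> N \<ge> K \<Longrightarrow> norm (R M N - s) < e / 2"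
      unfolding eventually_prod_sequentially by (auto simp: dist_norm)
    \<comment> \<open>The share of the mean due to the first \<open>K\<close> and the last
      \<open>K\<close> points of the antidiagonal.\<close>
    define A where "A N = (\<Sum>M<K. norm (R M (N - M) - s) / real (Suc N))
      + (\<Sum>M<K. norm (R (N - M) M - s) / real (Suc N))" for N
    have "A \<longlonglongrightarrow> 0"
      unfolding A_def using row col
      by (intro tendsto_add_zero tendsto_null_sum) (rule edge; simp)+
    then obtain N0 where N0: "\<And>N. N \<ge> N0 \<Longrightarrow> norm (A N) < e / 2"
      using LIMSEQ_D[of A 0 "e/2"] e by auto
    show "\<exists>n0. \<forall>n\<ge>n0. norm ((\<Sum>M\<le>n. R M (n - M) - s) / of_nat (Suc n) - 0) < e"
    proof (intro exI allI impI)
      fix N assume N: "N \<ge> max N0 (2 * K)"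
      have split: "{..N} = {..<K} \<union> {K..N - K} \<union> (\<lambda>M. N - M) ` {..<K}"
      proof -
        have "n \<in> (\<lambda>M. N - M) ` {..<K}" if "n \<le> N" "n > N - K" for n
          using that N by (intro image_eqI[of _ _ "N - n"]) auto
        then show ?thesis using N by force
      qed
      have "norm (\<Sum>M\<le>N. R M (N - M) - s) \<le> (\<Sum>M\<le>N. norm (R M (N - M) - s))"
        by (rule norm_sum)
      also have "\<dots> \<le> (\<Sum>M<K. norm (R M (N - M) - s)) + (\<Sum>M\<in>{K..N - K}. norm (R M (N - M) - s))
          + (\<Sum>M\<in>(\<lambda>M. N - M) ` {..<K}. norm (R M (N - M) - s))"
      proof -
        \<comment> \<open>Subadditivity suffices for the bound, so disjointness of the three pieces
          is never checked.\<close>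
        have un: "sum g (A \<union> B) \<le> sum g A + sum g B"
          if "finite A" "finite B" "\<And>x. g x \<ge> 0" for A B :: "nat set" and g :: "nat \<Rightarrow> real"
          using sum.union_inter[OF that(1,2), of g] sum_nonneg[of "A \<inter> B" g] that(3) by force
        show ?thesis
          unfolding split by (rule order_trans[OF un] add_right_mono un | simp)+
      qed
      also have "(\<Sum>M\<in>(\<lambda>M. N - M) ` {..<K}. norm (R M (N - M) - s))
          = (\<Sum>M<K. norm (R (N - M) M - s))"
        using N by (subst sum.reindex) (auto simp: inj_on_def intro!: sum.cong)
      also have "(\<Sum>M\<in>{K..N - K}. norm (R M (N - M) - s)) \<le> (\<Sum>M\<in>{K..N - K}. e / 2)"
        using K N by (intro sum_mono less_imp_le) auto
      also have "\<dots> \<le> real (Suc N) * (e / 2)"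
        using e by (simp add: mult_right_mono)
      finally have "norm (\<Sum>M\<le>N. R M (N - M) - s) / real (Suc N)
          \<le> ((\<Sum>M<K. norm (R M (N - M) - s)) + real (Suc N) * (e / 2)
            + (\<Sum>M<K. norm (R (N - M) M - s))) / real (Suc N)"
        by (intro divide_right_mono) auto
      also have "\<dots> = A N + e / 2"
        unfolding A_def by (simp add: add_divide_distrib sum_divide_distrib del: of_nat_Suc)
      also have "\<dots> < e"
        using N0[of N] N by auto
      finally show "norm ((\<Sum>M\<le>N. R M (N - M) - s) / of_nat (Suc N) - 0) < e"
        by (simp add: norm_divide del: of_nat_Suc)
    qed
  qed
  then have "(\<lambda>N. (\<Sum>M\<le>N. R M (N - M) - s) / of_nat (Suc N) + s) \<longlonglongrightarrow> 0 + s"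
    by (intro tendsto_intros)
  then show ?thesis
    by (simp add: sum_subtractf diff_divide_distrib del: of_nat_Suc)
qed

text \<open>Cesaro's theorem, as the case of an array that depends on its first index only.\<close>

lemma tendsto_arithmetic_mean:
  fixes X :: "nat \<Rightarrow> complex"
  assumes "X \<longlonglongrightarrow> L"
  shows "(\<lambda>N. (\<Sum>n\<le>N. X n) / of_nat (Suc N)) \<longlonglongrightarrow> L"
proof -
  have inv: "(\<lambda>N. inverse (of_nat (Suc N)) :: complex) \<longlonglongrightarrow> 0"
    by (rule LIMSEQ_Suc[OF lim_inverse_n])
  have "((\<lambda>(M, N). X M) \<longlongrightarrow> L) (sequentially \<times>\<^sub>F sequentially)"
    using filterlim_compose[OF assms filterlim_fst] by (simp add: case_prod_unfold)
  then show ?thesis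
    using tendsto_antidiagonal_mean[of "\<lambda>M N. X M" L]
      tendsto_mult_right_zero[OF inv] tendsto_mult[OF assms inv]
    by (simp add: divide_inverse del: of_nat_Suc)
qed

text \<open>Both sides count \<open>a m n\<close> exactly \<open>N + 1 - (m + n)\<close> times: on
  the left for \<open>M\<close> from \<open>m\<close> to \<open>N - n\<close>, on the right for
  \<open>L\<close> from \<open>m + n\<close> to \<open>N\<close>.\<close>

lemma sum_antidiagonal_rectangles:
  fixes a :: "nat \<Rightarrow> nat \<Rightarrow> 'a :: comm_monoid_add"
  shows "(\<Sum>M\<le>N. \<Sum>m\<le>M. \<Sum>n\<le>N - M. a m n) = (\<Sum>L\<le>N. \<Sum>i\<le>L. \<Sum>m\<le>i. a m (i - m))"
proof (induction N)
  case (Suc N)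
  \<comment> \<open>The triangle \<open>m + n \<le> K\<close>, listed by antidiagonals and by the
    columns \<open>n = K - M\<close>. Those columns, for \<open>K = Suc N\<close>, are what the
    rectangles gain when \<open>N\<close> increases by one.\<close>
  have tri: "(\<Sum>i\<le>K. \<Sum>m\<le>i. a m (i - m)) = (\<Sum>M\<le>K. \<Sum>m\<le>M. a m (K - M))" for K
  proof -
    have "(\<Sum>i\<le>K. \<Sum>m\<le>i. a m (i - m)) = (\<Sum>(m, n)\<in>{(m, n). m + n \<le> K}. a m n)"
      by (rule sum.triangle_reindex_eq[symmetric])
    also have "\<dots> = (\<Sum>(M, m)\<in>(SIGMA M:{..K}. {..M}). a m (K - M))"
      by (rule sum.reindex_bij_witness[of _ "\<lambda>(M, m). (m, K - M)" "\<lambda>(m, n). (K - n, m)"]) auto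
    also have "\<dots> = (\<Sum>M\<le>K. \<Sum>m\<le>M. a m (K - M))"
      by (simp add: sum.Sigma)
    finally show ?thesis .
  qed
  have "(\<Sum>M\<le>Suc N. \<Sum>m\<le>M. \<Sum>n\<le>Suc N - M. a m n)
      = (\<Sum>M\<le>N. (\<Sum>m\<le>M. \<Sum>n\<le>N - M. a m n) + (\<Sum>m\<le>M. a m (Suc N - M)))
        + (\<Sum>m\<le>Suc N. a m 0)"
    by (simp add: Suc_diff_le sum.distrib)
  also have "\<dots> = (\<Sum>M\<le>N. \<Sum>m\<le>M. \<Sum>n\<le>N - M. a m n) + (\<Sum>M\<le>Suc N. \<Sum>m\<le>M. a m (Suc N - M))"
    by (simp add: sum.distrib add.assoc)
  finally show ?case
    by (simp only: Suc.IH tri[of "Suc N", symmetric] sum.atMost_Suc[of _ N])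
qed simp

text \<open>Both values are limits of the same (C,1) means. Null rows and columns ensure that
  rectangular partial sums with one side fixed grow slower than the other side.\<close>

lemma double_sums_eq_diagonal_sum:
  assumes lim: "double_sums a s"
    and row: "\<And>m. (\<lambda>n. a m n) \<longlonglongrightarrow> 0" and col: "\<And>n. (\<lambda>m. a m n) \<longlonglongrightarrow> 0"
    and diag: "(\<lambda>i. \<Sum>m\<le>i. a m (i - m)) sums s'"
  shows "s = s'"
proof -
  define R where "R M N = (\<Sum>m\<le>M. \<Sum>n\<le>N. a m n)" for M N
  have mean0: "(\<lambda>N. (\<Sum>m\<le>M. \<Sum>n\<le>N. f m n) / of_nat (Suc N)) \<longlonglongrightarrow> 0"
    if "\<And>m. (\<lambda>n. f m n) \<longlonglongrightarrow> 0" for f :: "nat \<Rightarrow> nat \<Rightarrow> complex" and M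
    unfolding sum_divide_distrib[of _ "{..M}"]
    by (intro tendsto_null_sum tendsto_arithmetic_mean that)
  \<comment> \<open>\<open>double_sums\<close> uses strict upper bounds and \<open>R\<close>
    inclusive ones, hence the shift by one in both indices.\<close>
  have "filterlim (\<lambda>(M, N). (Suc M, Suc N)) (sequentially \<times>\<^sub>F sequentially)
      (sequentially \<times>\<^sub>F sequentially)"
    unfolding case_prod_unfold
    by (intro filterlim_Pair filterlim_compose[OF filterlim_Suc] filterlim_fst filterlim_snd)
  from filterlim_compose[OF lim[unfolded double_sums_def] this]
  have "((\<lambda>(M, N). R M N) \<longlongrightarrow> s) (sequentially \<times>\<^sub>F sequentially)"
    by (simp add: R_def case_prod_unfold lessThan_Suc_atMost)
  then have "(\<lambda>N. (\<Sum>M\<le>N. R M (N - M)) / of_nat (Suc N)) \<longlonglongrightarrow> s"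
  proof (rule tendsto_antidiagonal_mean)
    show "(\<lambda>N. R M N / of_nat (Suc N)) \<longlonglongrightarrow> 0" for M
      unfolding R_def by (rule mean0[OF row])
    show "(\<lambda>M. R M N / of_nat (Suc M)) \<longlonglongrightarrow> 0" for N
      unfolding R_def by (subst sum.swap) (rule mean0[OF col])
  qed
  moreover have "(\<lambda>N. (\<Sum>L\<le>N. \<Sum>i\<le>L. \<Sum>m\<le>i. a m (i - m)) / of_nat (Suc N)) \<longlonglongrightarrow> s'"
    using diag unfolding sums_def_le by (rule tendsto_arithmetic_mean)
  ultimately show ?thesis
    unfolding R_def sum_antidiagonal_rectangles by (rule LIMSEQ_unique)
qed

lemma double_suminf_eq:
  assumes "double_sums a s"
  shows "double_suminf a = s"
  unfolding double_suminf_def using assms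
  by (intro the_equality)
    (auto simp: double_sums_def prod_filter_eq_bot intro: tendsto_unique[rotated])

text \<open>A term is the mixed second difference of four rectangular partial sums, each eventually
  within 1 of \<open>s\<close>; hence the constant 4.\<close>

lemma double_sums_imp_bounded:
  assumes "double_sums a s"
  obtains K where "\<And>m n. m \<ge> K \<Longrightarrow> n \<ge> K \<Longrightarrow> norm (a m n) \<le> 4"
proof -
  define S where "S M N = (\<Sum>m<M. \<Sum>n<N. a m n)" for M N
  have "\<forall>\<^sub>F (M, N) in sequentially \<times>\<^sub>F sequentially. dist (S M N) s < 1"
    using tendstoD[OF assms[unfolded double_sums_def], of 1] by (simp add: case_prod_unfold S_def)
  then obtain K where K: "\<And>M N. M \<ge> K \<Longrightarrow> N \<ge> K \<Longrightarrow> norm (S M N - s) < 1"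
    unfolding eventually_prod_sequentially by (auto simp: dist_norm)
  have "norm (a m n) \<le> 4" if "m \<ge> K" "n \<ge> K" for m n
  proof -
    have "a m n = ((S (Suc m) (Suc n) - s) - (S m (Suc n) - s)) - ((S (Suc m) n - s) - (S m n - s))"
      by (simp add: S_def sum.distrib)
    also have "norm \<dots> \<le> (norm (S (Suc m) (Suc n) - s) + norm (S m (Suc n) - s))
        + (norm (S (Suc m) n - s) + norm (S m n - s))"
      by (intro order_trans[OF norm_triangle_ineq4] add_mono norm_triangle_ineq4)
    also have "\<dots> \<le> 4"
      using K[of "Suc m" "Suc n"] K[of m "Suc n"] K[of "Suc m" n] K[of m n] that by simp
    finally show ?thesis .
  qed
  then show ?thesis by (rule that)
qed

section \<open>The coefficients of (1+X)^a (1-X)^a\<close>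

text \<open>This compares coefficients in (1+X)^a (1-X)^a = (1-X^2)^a. The factors satisfy
  first-order differential equations, so their product \<open>P\<close> satisfies (1-X^2) P' = -2a X
  P, which determines \<open>P\<close> from its constant term.\<close>

lemma gbinomial_alternating_Vandermonde:
  fixes a :: "'a :: field_char_0"
  shows "(\<Sum>i\<le>n. (-1) ^ (n - i) * (a gchoose i) * (a gchoose (n - i)))
    = (if even n then (-1) ^ (n div 2) * (a gchoose (n div 2)) else 0)"
proof -
  define F where "F = Abs_fps (\<lambda>n. a gchoose n)"
  define G where "G = Abs_fps (\<lambda>n. (-1) ^ n * (a gchoose n))"
  define P where "P = F * G"
  have F: "fps_deriv F * (1 + fps_X) = fps_const a * F"
  proof (rule fps_ext)
    fix n show "(fps_deriv F * (1 + fps_X)) $ n = (fps_const a * F) $ n"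
      using gbinomial_mult_1[of a n] unfolding F_def
      by (cases n) (simp_all add: distrib_left algebra_simps)
  qed
  have G: "fps_deriv G * (1 - fps_X) = - fps_const a * G"
  proof (rule fps_ext)
    fix n show "(fps_deriv G * (1 - fps_X)) $ n = (- fps_const a * G) $ n"
      using arg_cong[OF gbinomial_mult_1[of a n], of "\<lambda>z. (-1) ^ n * z"] unfolding G_def
      by (cases n) (simp_all add: right_diff_distrib algebra_simps)
  qed
  have "fps_deriv P * (1 - fps_X\<^sup>2)
      = (fps_deriv F * (1 + fps_X)) * G * (1 - fps_X) + F * (fps_deriv G * (1 - fps_X)) * (1 + fps_X)"
    unfolding P_def by (simp add: algebra_simps power2_eq_square)
  also have "\<dots> = - 2 * fps_const a * (P * fps_X)"
    unfolding F G P_def by (simp add: algebra_simps del: fps_const_neg)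
  finally have ode: "fps_deriv P - fps_deriv P * fps_X\<^sup>2 = fps_const (- 2 * a) * (P * fps_X)"
    by (simp add: algebra_simps flip: fps_const_mult numeral_fps_const fps_const_neg)
  \<comment> \<open>The coefficient of X^(n+1) links indices of equal parity only, so
    \<open>P $ 0 = 1\<close> fixes the even coefficients and \<open>P $ 1 = 0\<close> kills the odd
    ones.\<close>
  have rec: "of_nat (n + 2) * P $ (n + 2) = (of_nat n - 2 * a) * P $ n" for n
    using arg_cong[OF ode, of "\<lambda>f. f $ Suc n"]
    by (cases n) (simp_all add: fps_X_power_mult_right_nth algebra_simps)
  have P1: "P $ 1 = 0"
    by (simp add: P_def F_def G_def fps_mult_nth)
  have "P $ n = (if even n then (-1) ^ (n div 2) * (a gchoose (n div 2)) else 0)"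
  proof (induction n rule: induct_nat_012)
    case (ge2 n)
    show ?case
    proof (cases "even n")
      case True
      then obtain k where k: "n = 2 * k" by blast
      have "of_nat (Suc k) * (2 * P $ (n + 2)) = (of_nat (2 * k) - 2 * a) * ((-1) ^ k * (a gchoose k))"
        using rec[of n] ge2 by (simp add: k algebra_simps)
      also have "\<dots> = of_nat (Suc k) * (2 * ((-1) ^ Suc k * (a gchoose Suc k)))"
        using arg_cong[OF gbinomial_mult_1[of a k], of "\<lambda>z. 2 * (-1) ^ k * z"]
        by (simp add: algebra_simps)
      finally have "P $ (n + 2) = (-1) ^ Suc k * (a gchoose Suc k)"
        unfolding mult_cancel_left of_nat_eq_0_iff by simp
      then show ?thesis by (simp add: k)
    next
      case False
      then show ?thesis using rec[of n] ge2 by (simp del: of_nat_Suc of_nat_add)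
    qed
  qed (use P1 in \<open>simp_all add: P_def F_def G_def\<close>)
  then show ?thesis
    by (simp add: P_def F_def G_def fps_mult_nth atLeast0AtMost mult_ac)
qed


section \<open>Laguerre polynomials and their zeros\<close>

text \<open>This is 1F1(-n; p; y) as a finite sum, the Laguerre polynomial without its Pochhammer
  prefactor. The binomial coefficients exhibit it as a binomial transform.\<close>

definition scaled_laguerre :: "complex \<Rightarrow> complex \<Rightarrow> nat \<Rightarrow> complex" where
  "scaled_laguerre p y n = (\<Sum>k\<le>n. of_nat (n choose k) * ((- y) ^ k / pochhammer p k))"

lemma pochhammer_neq_0:
  fixes p :: "'a :: real_normed_field"
  assumes "p \<notin> \<int>\<^sub>\<le>\<^sub>0"
  shows "pochhammer p n \<noteq> 0"
  using assms by (auto dest: pochhammer_eq_0_imp_nonpos_Int)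

lemma laguerre_eq_scaled_laguerre:
  "laguerre n (p - 1) y = pochhammer p n / fact n * scaled_laguerre p y n"
proof -
  have term_eq: "pochhammer (- of_nat n) k / pochhammer p k * (y ^ k / fact k)
      = of_nat (n choose k) * ((- y) ^ k / pochhammer p k)" for k
    unfolding binomial_gbinomial
    by (simp add: gbinomial_pochhammer power_minus[of y] mult_ac)
  have "hyp_1F1 (- of_nat n) p y = scaled_laguerre p y n"
    unfolding hyp_1F1_def scaled_laguerre_def term_eq by (rule suminf_finite) auto
  then show ?thesis by (simp add: laguerre_def)
qed

lemma scaled_laguerre_Suc_diff:
  "scaled_laguerre p y (Suc n) - scaled_laguerre p y n
    = (\<Sum>k\<le>n. of_nat (n choose k) * ((- y) ^ Suc k / pochhammer p (Suc k)))"
proof -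
  define c where "c k = (- y) ^ k / pochhammer p k" for k
  have "scaled_laguerre p y (Suc n)
      = c 0 + (\<Sum>k\<le>n. of_nat (n choose Suc k) * c (Suc k))
        + (\<Sum>k\<le>n. of_nat (n choose k) * c (Suc k))"
    unfolding scaled_laguerre_def c_def[symmetric]
    by (subst sum.atMost_Suc_shift) (simp add: sum.distrib distrib_right)
  also have "c 0 + (\<Sum>k\<le>n. of_nat (n choose Suc k) * c (Suc k))
      = (\<Sum>k\<le>Suc n. of_nat (n choose k) * c k)"
    by (subst sum.atMost_Suc_shift) simp
  finally show ?thesis by (simp add: scaled_laguerre_def c_def)
qed

text \<open>The three-term recurrence in terms of consecutive differences. In each summand the
  binomial coefficients combine to a factor \<open>p + of_nat k\<close>, which cancels the last
  factor of \<open>pochhammer p (Suc k)\<close>.\<close>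

lemma scaled_laguerre_recurrence:
  assumes p: "p \<notin> \<int>\<^sub>\<le>\<^sub>0"
  shows "(p + of_nat (Suc n)) * (scaled_laguerre p y (Suc (Suc n)) - scaled_laguerre p y (Suc n))
      - of_nat (Suc n) * (scaled_laguerre p y (Suc n) - scaled_laguerre p y n)
    = - y * scaled_laguerre p y (Suc n)"
proof -
  let ?c = "\<lambda>k. (- y) ^ k / pochhammer p k"
  have c: "(p + of_nat k) * ?c (Suc k) = - y * ?c k" for k
    using pochhammer_neq_0[OF p, of "Suc k"] by (simp add: pochhammer_Suc)
  have b: "(p + of_nat (Suc n)) * of_nat (Suc n choose k) - of_nat (Suc n) * of_nat (n choose k)
      = (p + of_nat k) * of_nat (Suc n choose k)" if "k \<le> Suc n" for k
  proof -
    have "of_nat (Suc n) * of_nat (n choose k) = (of_nat (Suc n) - of_nat k) * (of_nat (Suc n choose k) :: complex)"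
      using arg_cong[OF binomial_absorb_comp[of "Suc n" k], of "of_nat :: _ \<Rightarrow> complex"] that
      by (simp only: of_nat_mult of_nat_diff diff_Suc_1)
    then show ?thesis by (simp add: algebra_simps del: of_nat_Suc)
  qed
  have extend: "(\<Sum>k\<le>n. of_nat (n choose k) * ?c (Suc k)) = (\<Sum>k\<le>Suc n. of_nat (n choose k) * ?c (Suc k))"
    by simp
  have "(p + of_nat (Suc n)) * (scaled_laguerre p y (Suc (Suc n)) - scaled_laguerre p y (Suc n))
      - of_nat (Suc n) * (scaled_laguerre p y (Suc n) - scaled_laguerre p y n)
    = (\<Sum>k\<le>Suc n. ((p + of_nat (Suc n)) * of_nat (Suc n choose k) - of_nat (Suc n) * of_nat (n choose k)) * ?c (Suc k))"
    unfolding scaled_laguerre_Suc_diff extend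
    by (simp only: sum_distrib_left sum_subtractf left_diff_distrib mult.assoc)
  also have "\<dots> = (\<Sum>k\<le>Suc n. - y * (of_nat (Suc n choose k) * ?c k))"
  proof (rule sum.cong[OF refl])
    fix k assume "k \<in> {..Suc n}"
    then have "((p + of_nat (Suc n)) * of_nat (Suc n choose k) - of_nat (Suc n) * of_nat (n choose k)) * ?c (Suc k)
        = of_nat (Suc n choose k) * ((p + of_nat k) * ?c (Suc k))"
      by (subst b) (simp_all only: atMost_iff mult_ac)
    also have "\<dots> = - y * (of_nat (Suc n choose k) * ?c k)"
      unfolding c by (simp only: mult_ac)
    finally show "((p + of_nat (Suc n)) * of_nat (Suc n choose k) - of_nat (Suc n) * of_nat (n choose k)) * ?c (Suc k)
        = - y * (of_nat (Suc n choose k) * ?c k)" .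
  qed
  finally show ?thesis by (simp only: scaled_laguerre_def sum_distrib_left)
qed

text \<open>By the recurrence two consecutive zeros would propagate down to index 0, where the value
  is 1.\<close>

lemma scaled_laguerre_nonzero_unbounded:
  assumes p: "p \<notin> \<int>\<^sub>\<le>\<^sub>0"
  obtains n where "n \<ge> N" "scaled_laguerre p y n \<noteq> 0"
proof -
  have "\<not> (scaled_laguerre p y n = 0 \<and> scaled_laguerre p y (Suc n) = 0)" for n
  proof (induction n)
    case 0
    then show ?case by (simp add: scaled_laguerre_def)
  next
    case (Suc n)
    then show ?case using scaled_laguerre_recurrence[OF p, of n y] by (auto simp del: of_nat_Suc)
  qed
  from this[of N] show ?thesis using that[of N] that[of "Suc N"] by auto
qed

text \<open>With \<open>c = p + of_nat m\<close> this is the quotient of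
  \<open>pochhammer p (m + n)\<close> by \<open>pochhammer p (m + Suc d + n)\<close>, which compares
  two rows of the double series; \<open>Suc d\<close> guarantees at least one decaying
  factor.\<close>

lemma inverse_pochhammer_tendsto_0:
  fixes c :: complex
  shows "(\<lambda>n. inverse (pochhammer (c + of_nat n) (Suc d))) \<longlonglongrightarrow> 0"
proof -
  have base: "(\<lambda>n. inverse (c + of_nat n)) \<longlonglongrightarrow> 0" for c :: complex
    by (rule filterlim_compose[OF tendsto_inverse_0
          tendsto_add_filterlim_at_infinity[OF tendsto_const tendsto_of_nat]])
  show ?thesis
  proof (induction d arbitrary: c)
    case 0
    show ?case using base by simp
  next
    case (Suc d)
    have "(\<lambda>n. inverse (c + of_nat n) * inverse (pochhammer ((c + 1) + of_nat n) (Suc d))) \<longlonglongrightarrow> 0 * 0"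
      by (intro tendsto_mult Suc.IH base)
    then show ?case
      by (subst pochhammer_rec) (simp add: add_ac)
  qed
qed

section \<open>The series 0F1 and the Bessel function\<close>

lemma hyp_0F1_sums:
  assumes p: "p \<notin> \<int>\<^sub>\<le>\<^sub>0"
  shows "(\<lambda>n. z ^ n / (pochhammer p n * fact n)) sums hyp_0F1 p z"
proof -
  let ?f = "\<lambda>n. z ^ n / (pochhammer p n * fact n)"
  have "filterlim (\<lambda>n. p + of_nat n) at_infinity sequentially"
    by (rule tendsto_add_filterlim_at_infinity[OF tendsto_const tendsto_of_nat])
  \<comment> \<open>The term \<open>2 * norm z\<close> yields the ratio 1/2; the extra 1 keeps the
    bound positive when \<open>z = 0\<close>.\<close>
  then have "\<forall>\<^sub>F n in sequentially. norm (p + of_nat n) \<ge> 2 * norm z + 1"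
    unfolding filterlim_at_infinity[OF order_refl]
    by (rule allE[of _ "2 * norm z + 1"]) (simp add: add_nonneg_pos)
  then obtain N where N: "\<And>n. n \<ge> N \<Longrightarrow> norm (p + of_nat n) \<ge> 2 * norm z + 1"
    by (auto simp: eventually_sequentially)
  have "summable ?f"
  proof (rule summable_ratio_test)
    show "norm (?f (Suc n)) \<le> 1 / 2 * norm (?f n)" if "n \<ge> N" for n
    proof -
      have "norm z / (norm (p + of_nat n) * norm (of_nat (Suc n) :: complex)) \<le> 1 / 2"
      proof -
        have "2 * norm z \<le> norm (p + of_nat n) * 1"
          using N[OF that] by simp
        also have "\<dots> \<le> norm (p + of_nat n) * real (Suc n)"
          by (intro mult_left_mono) auto
        finally have "2 * norm z \<le> norm (p + of_nat n) * norm (of_nat (Suc n) :: complex)"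
          by (simp only: norm_of_nat)
        moreover have "norm (p + of_nat n) > 0"
          using N[OF that] norm_ge_zero[of z] by linarith
        ultimately show ?thesis
          by (subst pos_divide_le_eq) (auto simp del: of_nat_Suc)
      qed
      moreover have "norm (?f (Suc n)) = norm z / (norm (p + of_nat n) * norm (of_nat (Suc n) :: complex)) * norm (?f n)"
        by (simp add: pochhammer_Suc norm_mult norm_divide norm_power mult_ac del: of_nat_Suc)
      ultimately show ?thesis
        by (simp only: mult_right_mono[OF _ norm_ge_zero])
    qed
  qed simp
  then show ?thesis
    unfolding hyp_0F1_def by (rule summable_sums)
qed

text \<open>Termwise, \<open>pochhammer p k\<close> is a quotient of Gamma values and the two
  complex powers of \<open>w\<close> multiply to \<open>w ^ (2 * k)\<close>. At \<open>w = 0\<close>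
  with \<open>p \<noteq> 1\<close> the left side is 1 but \<open>cpow w (1 - p)\<close> is 0, so
  that case is excluded.\<close>

lemma hyp_0F1_eq_bessel_J:
  assumes p: "p \<notin> \<int>\<^sub>\<le>\<^sub>0" and w: "w \<noteq> 0 \<or> p = 1"
  shows "hyp_0F1 p (- (w\<^sup>2)) = Gamma p * cpow w (1 - p) * bessel_J (p - 1) (2 * w)"
proof -
  define b where "b k = (-1) ^ k * cpow w (2 * of_nat k + (p - 1)) / (fact k * Gamma (p + of_nat k))"
    for k
  have powers: "cpow w (1 - p) * cpow w (2 * of_nat k + (p - 1)) = w ^ (2 * k)" for k
  proof (cases "w = 0")
    case True
    then show ?thesis using w by (simp add: cpow_def)
  next
    case False
    have "w powr (1 - p) * w powr (2 * of_nat k + (p - 1)) = w powr of_nat (2 * k)"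
      by (simp add: powr_add[symmetric])
    with False show ?thesis by (simp only: cpow_def powr_nat simp_thms if_False)
  qed
  have G: "Gamma p \<noteq> 0" using p by (simp add: Gamma_eq_zero_iff)
  have term_eq: "(- (w\<^sup>2)) ^ k / (pochhammer p k * fact k) = Gamma p * cpow w (1 - p) * b k" for k
  proof -
    have "Gamma p * cpow w (1 - p) * b k
        = (-1) ^ k * (cpow w (1 - p) * cpow w (2 * of_nat k + (p - 1)))
          / (fact k * (Gamma (p + of_nat k) / Gamma p))"
      by (simp add: b_def)
    also have "\<dots> = (- (w\<^sup>2)) ^ k / (pochhammer p k * fact k)"
      unfolding powers pochhammer_Gamma[OF p] power_minus[of "w\<^sup>2"] by (simp add: power_mult)
    finally show ?thesis by simp
  qed
  have C: "cpow w (1 - p) \<noteq> 0"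
    using w by (auto simp: cpow_def)
  have sums: "(\<lambda>k. Gamma p * cpow w (1 - p) * b k) sums hyp_0F1 p (- (w\<^sup>2))"
    using hyp_0F1_sums[OF p, of "- (w\<^sup>2)"] unfolding term_eq .
  then have "summable b"
    using G C by (auto dest: sums_summable simp: mult.assoc)
  then have "Gamma p * cpow w (1 - p) * suminf b = hyp_0F1 p (- (w\<^sup>2))"
    using sums by (auto dest: sums_unique simp: suminf_mult)
  moreover have "bessel_J (p - 1) (2 * w) = suminf b"
    unfolding bessel_J_def b_def by (simp add: algebra_simps)
  ultimately show ?thesis by simp
qed

section \<open>Generating functions and antidiagonal sums\<close>

text \<open>A binomial transform multiplies the exponential generating function by the exponential
  series; \<open>c\<close> rescales the variable so that both signs are covered.\<close>

lemma scaled_laguerre_egf: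
  "Abs_fps (\<lambda>n. c ^ n * scaled_laguerre p y n / fact n)
    = fps_exp c * Abs_fps (\<lambda>k. (- (c * y)) ^ k / (pochhammer p k * fact k))"
proof (rule fps_ext)
  fix n
  have "c ^ n * (of_nat (n choose k) * ((- y) ^ k / pochhammer p k)) / fact n
      = (- (c * y)) ^ k / (pochhammer p k * fact k) * (c ^ (n - k) / fact (n - k))"
    if "k \<le> n" for k
  proof -
    have "c ^ n = c ^ k * c ^ (n - k)" using that by (simp flip: power_add)
    then show ?thesis
      using that
      by (simp add: binomial_fact power_minus[of y] power_minus[of "c * y"] power_mult_distrib mult_ac)
  qed
  then show "Abs_fps (\<lambda>n. c ^ n * scaled_laguerre p y n / fact n) $ n
      = (fps_exp c * Abs_fps (\<lambda>k. (- (c * y)) ^ k / (pochhammer p k * fact k))) $ n"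
    unfolding scaled_laguerre_def
    by (subst mult.commute)
      (simp add: fps_mult_nth atLeast0AtMost sum_distrib_left sum_divide_distrib)
qed

text \<open>For \<open>a = p + of_nat n - 1\<close>, \<open>a gchoose j\<close> equals
  \<open>pochhammer p n / (pochhammer p (n - j) * fact j)\<close>, so the sum becomes the
  alternating Vandermonde sum. As \<open>a\<close> varies with \<open>n\<close>, this works one
  coefficient at a time.\<close>

lemma hyp_0F1_product_coefficient:
  fixes p :: complex
  assumes p: "p \<notin> \<int>\<^sub>\<le>\<^sub>0"
  shows "pochhammer p n * (\<Sum>i\<le>n. (-1) ^ (n - i) /
        (pochhammer p i * fact i * (pochhammer p (n - i) * fact (n - i))))
    = (if even n then (-1) ^ (n div 2) / (pochhammer p (n div 2) * fact (n div 2)) else 0)"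
proof -
  define a where "a = p + of_nat n - 1"
  have nz: "pochhammer p k \<noteq> 0" for k by (rule pochhammer_neq_0[OF p])
  have gb: "a gchoose j = pochhammer p n / (pochhammer p (n - j) * fact j)" if "j \<le> n" for j
  proof -
    have "a gchoose j = pochhammer (p + of_nat (n - j)) j / fact j"
      using that by (simp add: a_def gbinomial_pochhammer' of_nat_diff algebra_simps)
    moreover have "pochhammer p n = pochhammer p (n - j) * pochhammer (p + of_nat (n - j)) j"
      using pochhammer_product'[of p "n - j" j] that by simp
    ultimately show ?thesis using nz by simp
  qed
  \<comment> \<open>One factor \<open>pochhammer p n\<close> for each of the two binomial
    coefficients.\<close>
  have "pochhammer p n * (pochhammer p n * (\<Sum>i\<le>n. (-1) ^ (n - i) /
        (pochhammer p i * fact i * (pochhammer p (n - i) * fact (n - i)))))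
      = (\<Sum>i\<le>n. (-1) ^ (n - i) * (a gchoose i) * (a gchoose (n - i)))"
    unfolding sum_distrib_left by (intro sum.cong refl) (simp add: gb mult.left_commute mult.commute)
  also have "\<dots> = (if even n then (-1) ^ (n div 2) * (a gchoose (n div 2)) else 0)"
    by (rule gbinomial_alternating_Vandermonde)
  also have "\<dots> = pochhammer p n *
      (if even n then (-1) ^ (n div 2) / (pochhammer p (n div 2) * fact (n div 2)) else 0)"
  proof (cases "even n")
    case True
    then have "n - n div 2 = n div 2" by auto
    with True show ?thesis by (simp add: gb)
  qed simp
  finally show ?thesis using nz[of n] by simp
qed

text \<open>Multiplying the generating functions for \<open>c = 1\<close> and \<open>c = - 1\<close>
  cancels the exponentials; the remaining coefficient is \<open>(- y) ^ n\<close> times the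
  alternating sum just evaluated.\<close>

lemma scaled_laguerre_diagonal_sum:
  assumes p: "p \<notin> \<int>\<^sub>\<le>\<^sub>0"
  shows "pochhammer p n * (\<Sum>i\<le>n. scaled_laguerre p y i / fact i *
        ((-1) ^ (n - i) * scaled_laguerre p y (n - i) / fact (n - i)))
    = (if even n then (- (y\<^sup>2)) ^ (n div 2) / (pochhammer p (n div 2) * fact (n div 2)) else 0)"
proof -
  let ?E = "\<lambda>c. Abs_fps (\<lambda>n. c ^ n * scaled_laguerre p y n / fact n)"
  let ?C = "\<lambda>c. Abs_fps (\<lambda>k. (- (c * y)) ^ k / (pochhammer p k * fact k))"
  have "?E 1 * ?E (- 1) = (fps_exp 1 * fps_exp (- 1)) * (?C 1 * ?C (- 1))"
    unfolding scaled_laguerre_egf by (simp only: mult_ac)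
  also have "fps_exp 1 * fps_exp (- 1) = (1 :: complex fps)"
    by (simp flip: fps_exp_add_mult)
  finally have "(?E 1 * ?E (- 1)) $ n = (?C 1 * ?C (- 1)) $ n" by simp
  then have "(\<Sum>i\<le>n. scaled_laguerre p y i / fact i *
        ((-1) ^ (n - i) * scaled_laguerre p y (n - i) / fact (n - i)))
      = (\<Sum>i\<le>n. (- y) ^ i / (pochhammer p i * fact i) * (y ^ (n - i) / (pochhammer p (n - i) * fact (n - i))))"
    by (simp add: fps_mult_nth atLeast0AtMost)
  also have "\<dots> = (- y) ^ n * (\<Sum>i\<le>n. (-1) ^ (n - i) /
        (pochhammer p i * fact i * (pochhammer p (n - i) * fact (n - i))))"
    unfolding sum_distrib_left
  proof (intro sum.cong refl)
    fix i assume "i \<in> {..n}"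
    then have "(- y) ^ n = (- y) ^ i * (- y) ^ (n - i)" by (simp flip: power_add)
    then show "(- y) ^ i / (pochhammer p i * fact i) * (y ^ (n - i) / (pochhammer p (n - i) * fact (n - i)))
      = (- y) ^ n * ((-1) ^ (n - i) / (pochhammer p i * fact i * (pochhammer p (n - i) * fact (n - i))))"
      by (simp add: power_minus[of y "n - i"])
  qed
  finally show ?thesis
    using hyp_0F1_product_coefficient[OF p, of n]
    by (auto simp: mult.left_commute[of "pochhammer p n"] power_mult power_minus[of "y\<^sup>2"] elim!: evenE)
qed

section \<open>Evaluation of the double series\<close>

theorem mainTheorem6:
  fixes p x y :: complex
  defines "t \<equiv> \<lambda>m n. pochhammer p (m + n) * (-1) ^ n * x ^ (m + n) / (pochhammer p m * pochhammer p n)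
                      * laguerre m (p - 1) y * laguerre n (p - 1) y"
  assumes "p \<notin> \<int>\<^sub>\<le>\<^sub>0"
    and "double_summable t"
  shows "double_suminf t = hyp_0F1 p (- (x\<^sup>2 * y\<^sup>2))
       \<and> (x * y \<noteq> 0 \<or> p = 1 \<longrightarrow>
           hyp_0F1 p (- (x\<^sup>2 * y\<^sup>2)) = Gamma p * cpow (x * y) (1 - p) * bessel_J (p - 1) (2 * x * y))"
proof -
  note p = assms(2)
  define u where "u = scaled_laguerre p y"
  have nz: "pochhammer p k \<noteq> 0" for k by (rule pochhammer_neq_0[OF p])
  \<comment> \<open>The Pochhammer prefactors of the two Laguerre polynomials cancel the
    denominator; what remains is symmetric in \<open>m\<close> and \<open>n\<close> up to
    sign.\<close>
  have t: "t m n = pochhammer p (m + n) * (-1) ^ n * x ^ (m + n) * (u m / fact m) * (u n / fact n)" for m n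
    by (simp add: t_def laguerre_eq_scaled_laguerre u_def nz)
  obtain s where s: "double_sums t s"
    using assms(3) by (auto simp: double_summable_def)
  obtain K where K: "\<And>m n. m \<ge> K \<Longrightarrow> n \<ge> K \<Longrightarrow> norm (t m n) \<le> 4"
    using double_sums_imp_bounded[OF s] by blast
  have row: "(\<lambda>n. t m n) \<longlonglongrightarrow> 0" for m
  proof (cases "x = 0")
    case True
    then have "\<forall>\<^sub>F n in sequentially. t m n = 0"
      by (intro eventually_sequentiallyI[of 1]) (simp add: t)
    then show ?thesis by (rule tendsto_eventually)
  next
    case False
    \<comment> \<open>\<open>k \<ge> K\<close> makes row \<open>k\<close> bounded from column
      \<open>K\<close> on, \<open>k > m\<close> leaves a decaying Pochhammer quotient, and
      \<open>u k \<noteq> 0\<close> permits division.\<close>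
    obtain k where k: "k \<ge> K + Suc m" "u k \<noteq> 0"
      using scaled_laguerre_nonzero_unbounded[OF p, of "K + Suc m" y] unfolding u_def by blast
    define d where "d = k - Suc m"
    have kd: "k = m + Suc d" using k by (simp add: d_def)
    \<comment> \<open>The part of the ratio of row \<open>m\<close> to row \<open>k\<close> that
      does not depend on \<open>n\<close>; the signs \<open>(-1) ^ n\<close> cancel.\<close>
    define c where "c = (u m / fact m) / (u k / fact k) / x ^ Suc d"
    have "t m n = c * (inverse (pochhammer ((p + of_nat m) + of_nat n) (Suc d)) * t k n)" for n
    proof -
      define P where "P = pochhammer ((p + of_nat m) + of_nat n) (Suc d)"
      define X where "X = x ^ Suc d"
      have P: "pochhammer p (k + n) = pochhammer p (m + n) * P"
        using pochhammer_product'[of p "m + n" "Suc d"] by (simp add: P_def kd add_ac)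
      have X: "x ^ (k + n) = x ^ (m + n) * X"
        unfolding X_def kd power_add[symmetric] by (rule arg_cong[of _ _ "power x"]) simp
      have "P \<noteq> 0" "X \<noteq> 0"
        using nz[of "k + n"] P False by (auto simp: X_def)
      then show ?thesis
        unfolding P_def[symmetric] c_def X_def[symmetric] t P X using k(2) by simp
    qed
    moreover have "(\<lambda>n. inverse (pochhammer ((p + of_nat m) + of_nat n) (Suc d)) * t k n) \<longlonglongrightarrow> 0"
    proof (rule lim_null_mult_right_bounded[OF inverse_pochhammer_tendsto_0])
      show "\<forall>\<^sub>F n in sequentially. norm (t k n) \<le> 4"
        using K k(1) by (intro eventually_sequentiallyI[of K]) auto
    qed
    ultimately show ?thesis
      by (simp add: tendsto_mult_right_zero)
  qed
  have col: "(\<lambda>m. t m n) \<longlonglongrightarrow> 0" for n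
  proof (rule tendsto_norm_zero_cancel)
    have "norm (t m n) = norm (t n m)" for m
      by (simp add: t norm_mult norm_divide norm_power add.commute[of m n] mult_ac)
    then show "(\<lambda>m. norm (t m n)) \<longlonglongrightarrow> 0"
      using tendsto_norm_zero[OF row[of n]] by simp
  qed
  have diag: "(\<lambda>i. \<Sum>m\<le>i. t m (i - m)) sums hyp_0F1 p (- (x\<^sup>2 * y\<^sup>2))"
  proof -
    let ?D = "\<lambda>i. \<Sum>m\<le>i. t m (i - m)"
    have D: "?D i = x ^ i * (if even i then (- (y\<^sup>2)) ^ (i div 2) / (pochhammer p (i div 2) * fact (i div 2)) else 0)" for i
      unfolding scaled_laguerre_diagonal_sum[OF p, symmetric] sum_distrib_left
      by (intro sum.cong refl) (simp add: t u_def)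
    have "(\<lambda>k. ?D (2 * k)) sums hyp_0F1 p (- (x\<^sup>2 * y\<^sup>2))"
    proof -
      have "?D (2 * k) = (- (x\<^sup>2 * y\<^sup>2)) ^ k / (pochhammer p k * fact k)" for k
        unfolding D
        by (simp add: power_mult power_mult_distrib power_minus[of "y\<^sup>2"] power_minus[of "x\<^sup>2 * y\<^sup>2"])
      then show ?thesis using hyp_0F1_sums[OF p] by simp
    qed
    \<comment> \<open>Odd antidiagonals vanish, so the sum over all of them can be reindexed from
      the even ones.\<close>
    moreover have "?D i = 0" if "i \<notin> range ((*) 2)" for i
      using that unfolding D by (auto elim!: evenE)
    ultimately show ?thesis
      by (subst (asm) sums_mono_reindex) (auto simp: strict_mono_def)
  qed
  have "double_suminf t = hyp_0F1 p (- (x\<^sup>2 * y\<^sup>2))"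
    using double_suminf_eq[OF s] double_sums_eq_diagonal_sum[OF s row col diag] by simp
  moreover have "hyp_0F1 p (- (x\<^sup>2 * y\<^sup>2))
      = Gamma p * cpow (x * y) (1 - p) * bessel_J (p - 1) (2 * x * y)"
    if "x * y \<noteq> 0 \<or> p = 1"
    using hyp_0F1_eq_bessel_J[OF p that] by (simp only: power_mult_distrib mult.assoc)
  ultimately show ?thesis by blast
qed

end
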